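(* Let $\mathbb N=\{1,2,3,\dots\}$ and $L=\mathbb N\times\mathbb N\times(\mathbb N\cup\{\infty\})$, ordered by the partial order $\le$ which is the transitive closure of the relation holding between $(n_1,i_1,j_1)$ and $(n_2,i_2,j_2)$ if and only if at least one of the following holds: (a) $n_1=n_2$, $i_1=i_2$, $j_1\le j_2$; (b) $n_1=n_2$, $i_2=j_2=j_1$, $i_1\le i_2$; (c) $n_2=n_1+1$, $j_1\le i_2$, $j_2=\infty$. Endow $L$ with its Scott topology $\sigma(L)$. Then $L$ is a tapered closed subset of $(L,\sigma(L))$, but $L\notin\mathbf{KF}(L)$ and there is no directed subset $D$ of $L$ with $cl(D)=L$.
   Context: In $\mathbb N\cup\{\infty\}$, $m\le\infty$ for all $m$. The Scott topology on a poset: $U$ is open iff $U$ is an upper set and every directed set whose supremum exists and lies in $U$ meets $U$. The specialization order of a $T_0$ space is $x\le y$ iff $x\in cl(\{y\})$. A monotone convergence space is a $T_0$ space in which the closure of every directed set (in the specialization order) is the closure of a unique point. A subset $A$ of a $T_0$ space $X$ is tapered if for every continuous map $f:X\to Y$ into a monotone convergence space $Y$, the supremum of $f(A)$ exists in $Y$ (in the specialization order). The tapered closed subsets of $X$ are exactly the members of the smallest family of closed sets containing all $cl(\{x\})$, $x\in X$, and closed under suprema (closures of unions) of subfamilies directed under inclusion. $Q(X)$ denotes the set of compact saturated subsets of $X$ (saturated means upper set in the specialization order). A family $\mathfrak K\subseteq Q(X)$ is filtered if it is nonempty and any two members contain a common member. A nonempty set $A\subseteq X$ is a $KF$-set if there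 is a filtered family $\mathfrak K\subseteq Q(X)$ such that $cl(A)$ is minimal among the closed sets that intersect all members of $\mathfrak K$; $\mathbf{KF}(X)$ is the set of closed $KF$-sets. Here $\mathbf{KF}(L)$ is taken for $(L,\sigma(L))$. *)

theory Defs
  imports "HOL-Analysis.Analysis" "HOL-Library.Extended_Nat"
begin

section \<open>Posets and the Scott topology\<close>

text \<open>A poset is a carrier set \<open>P\<close> with a relation \<open>r\<close> such that \<open>partial_order_on P r\<close>;
  \<open>(x, y) \<in> r\<close> means that \<open>x\<close> is below \<open>y\<close>.\<close>

definition directed_set :: "'a set \<Rightarrow> 'a rel \<Rightarrow> 'a set \<Rightarrow> bool" where
  "directed_set P r D \<longleftrightarrow>
     D \<subseteq> P \<and> D \<noteq> {} \<and> (\<forall>x\<in>D. \<forall>y\<in>D. \<exists>z\<in>D. (x, z) \<in> r \<and> (y, z) \<in> r)"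

definition supremum :: "'a set \<Rightarrow> 'a rel \<Rightarrow> 'a set \<Rightarrow> 'a \<Rightarrow> bool" where
  "supremum P r A s \<longleftrightarrow>
     s \<in> P \<and> (\<forall>x\<in>A. (x, s) \<in> r) \<and> (\<forall>u\<in>P. (\<forall>x\<in>A. (x, u) \<in> r) \<longrightarrow> (s, u) \<in> r)"

definition upper_set :: "'a set \<Rightarrow> 'a rel \<Rightarrow> 'a set \<Rightarrow> bool" where
  "upper_set P r U \<longleftrightarrow> U \<subseteq> P \<and> (\<forall>x\<in>U. \<forall>y\<in>P. (x, y) \<in> r \<longrightarrow> y \<in> U)"

definition scott_open :: "'a set \<Rightarrow> 'a rel \<Rightarrow> 'a set \<Rightarrow> bool" where
  "scott_open P r U \<longleftrightarrow>
     upper_set P r U \<and>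
     (\<forall>D s. directed_set P r D \<and> supremum P r D s \<and> s \<in> U \<longrightarrow> D \<inter> U \<noteq> {})"

definition scott_topology :: "'a set \<Rightarrow> 'a rel \<Rightarrow> 'a topology" where
  "scott_topology P r = topology (scott_open P r)"

lemma istopology_scott_open: "istopology (scott_open P r)"
proof -
  have "scott_open P r (U \<inter> V)" if U: "scott_open P r U" and V: "scott_open P r V" for U V
    unfolding scott_open_def
  proof (intro conjI allI impI)
    show "upper_set P r (U \<inter> V)"
      using U V unfolding scott_open_def upper_set_def by blast
  next
    fix D s
    assume D: "directed_set P r D \<and> supremum P r D s \<and> s \<in> U \<inter> V"
    obtain x where x: "x \<in> D" "x \<in> U"
      using U D unfolding scott_open_def by blast
    obtain y where y: "y \<in> D" "y \<in> V"
      using V D unfolding scott_open_def by blast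
    obtain z where z: "z \<in> D" "(x, z) \<in> r" "(y, z) \<in> r"
      using D x y unfolding directed_set_def by blast
    have "z \<in> P"
      using D z unfolding directed_set_def by blast
    then have "z \<in> U \<inter> V"
      using U V x y z unfolding scott_open_def upper_set_def by blast
    then show "D \<inter> (U \<inter> V) \<noteq> {}"
      using z by blast
  qed
  moreover have "scott_open P r (\<Union>\<K>)" if "\<forall>K\<in>\<K>. scott_open P r K" for \<K>
    unfolding scott_open_def
  proof (intro conjI allI impI)
    show "upper_set P r (\<Union>\<K>)"
      using that unfolding scott_open_def upper_set_def by blast
  next
    fix D s
    assume D: "directed_set P r D \<and> supremum P r D s \<and> s \<in> \<Union>\<K>"
    then obtain K where K: "K \<in> \<K>" "s \<in> K"
      by blast
    then have "D \<inter> K \<noteq> {}"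
      using that D unfolding scott_open_def by blast
    then show "D \<inter> \<Union>\<K> \<noteq> {}"
      using K by blast
  qed
  ultimately show ?thesis
    unfolding istopology_def by blast
qed

lemma openin_scott_topology: "openin (scott_topology P r) U \<longleftrightarrow> scott_open P r U"
  by (simp add: scott_topology_def istopology_scott_open topology_inverse')

lemma topspace_scott_topology: "topspace (scott_topology P r) = P"
proof
  show "topspace (scott_topology P r) \<subseteq> P"
    using openin_topspace[of "scott_topology P r"]
    unfolding openin_scott_topology scott_open_def upper_set_def by blast
  have "scott_open P r P"
    unfolding scott_open_def upper_set_def directed_set_def by blast
  then show "P \<subseteq> topspace (scott_topology P r)"
    by (simp add: openin_scott_topology openin_subset)
qed


section \<open>Monotone convergence spaces and tapered sets\<close>

definition specialization :: "'a topology \<Rightarrow> 'a rel" where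
  "specialization X = {(x, y). x \<in> topspace X \<and> y \<in> topspace X \<and> x \<in> X closure_of {y}}"

definition monotone_convergence_space :: "'a topology \<Rightarrow> bool" where
  "monotone_convergence_space X \<longleftrightarrow>
     t0_space X \<and>
     (\<forall>D. directed_set (topspace X) (specialization X) D \<longrightarrow>
        (\<exists>!x. x \<in> topspace X \<and> X closure_of D = X closure_of {x}))"

text \<open>A HOL formula cannot quantify over all spaces \<open>Y\<close> regardless of the type of their points.
  The type of the points of \<open>Y\<close> is therefore an explicit parameter; in a theorem concluding
  \<open>tapered TYPE('b) X A\<close> with a free type variable \<open>'b\<close>, it is universally quantified.\<close>

definition tapered :: "'b itself \<Rightarrow> 'a topology \<Rightarrow> 'a set \<Rightarrow> bool" where
  "tapered (_ :: 'b itself) X A \<longleftrightarrow>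
     t0_space X \<and> A \<subseteq> topspace X \<and>
     (\<forall>(Y :: 'b topology) f. monotone_convergence_space Y \<and> continuous_map X Y f \<longrightarrow>
        (\<exists>s. supremum (topspace Y) (specialization Y) (f ` A) s))"


section \<open>KF-sets\<close>

definition compact_saturated :: "'a topology \<Rightarrow> 'a set set" where
  "compact_saturated X = {K. compactin X K \<and> upper_set (topspace X) (specialization X) K}"

definition filtered_family :: "'a set set \<Rightarrow> bool" where
  "filtered_family \<K> \<longleftrightarrow> \<K> \<noteq> {} \<and> (\<forall>K1\<in>\<K>. \<forall>K2\<in>\<K>. \<exists>K\<in>\<K>. K \<subseteq> K1 \<inter> K2)"

definition closed_meeting :: "'a topology \<Rightarrow> 'a set set \<Rightarrow> 'a set set" where
  "closed_meeting X \<K> = {C. closedin X C \<and> (\<forall>K\<in>\<K>. C \<inter> K \<noteq> {})}"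

definition KF_set :: "'a topology \<Rightarrow> 'a set \<Rightarrow> bool" where
  "KF_set X A \<longleftrightarrow>
     A \<noteq> {} \<and> A \<subseteq> topspace X \<and>
     (\<exists>\<K>. \<K> \<subseteq> compact_saturated X \<and> filtered_family \<K> \<and>
        X closure_of A \<in> closed_meeting X \<K> \<and>
        (\<forall>C \<in> closed_meeting X \<K>. C \<subseteq> X closure_of A \<longrightarrow> C = X closure_of A))"

definition KF :: "'a topology \<Rightarrow> 'a set set" where
  "KF X = {A. closedin X A \<and> KF_set X A}"


section \<open>The poset\<close>

text \<open>Zero is excluded from all three coordinates.\<close>

definition L_set :: "(nat \<times> nat \<times> enat) set" where
  "L_set = {(n, i, j). 1 \<le> n \<and> 1 \<le> i \<and> 1 \<le> j}"

definition L_step :: "(nat \<times> nat \<times> enat) rel" where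
  "L_step = {((n1, i1, j1), (n2, i2, j2)).
     (n1, i1, j1) \<in> L_set \<and> (n2, i2, j2) \<in> L_set \<and>
     ((n1 = n2 \<and> i1 = i2 \<and> j1 \<le> j2) \<or>
      (n1 = n2 \<and> enat i2 = j2 \<and> j2 = j1 \<and> i1 \<le> i2) \<or>
      (n2 = n1 + 1 \<and> j1 \<le> enat i2 \<and> j2 = \<infinity>))}"

definition L_order :: "(nat \<times> nat \<times> enat) rel" where
  "L_order = L_step\<^sup>+"

end

theory Submission
  imports Defs
begin

text \<open>Write \<open>E\<^sub>n\<close> for the set of points whose level, that is first coordinate, is at most \<open>n\<close>.
  The order has a short closed form (\<open>L_order_iff\<close>): inside a level a point lies below the
  higher points of its own column \<open>i\<close>, and below \<open>(n, i', j')\<close> whenever \<open>i' \<le> j'\<close> and \<open>i'\<close> is at least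
  both its column and its height; beyond its level it only lies below points \<open>(n + 1, i', \<infinity>)\<close>, which
  are maximal. So comparable points differ by at most one in level.

  The whole space is tapered by a two-stage approximation. The diagonal points \<open>(n, k, k)\<close> form a
  chain. Every point \<open>(n, i, j)\<close> with finite \<open>j\<close> is below a member of it, the points \<open>(n, i, \<infinity>)\<close> are
  suprema of columns, and the points \<open>(n, i, \<infinity>)\<close> dominate the finite part of the level below; hence
  the closure of the chain contains \<open>E\<^sub>n\<close> (\<open>levels_subset_closure_diagonal\<close>). Thus each \<open>E\<^sub>n\<close> is tapered,
  and so is the increasing union of these sets, since in a monotone convergence space the suprema
  of the images of the \<open>E\<^sub>n\<close> again form a directed set.

  The two negative claims rest on each \<open>E\<^sub>n\<close> being a proper closed set
  (\<open>closedin_levels\<close>). A directed set containing a point of level \<open>n\<close> stays in \<open>E\<^sub>n\<^sub>+\<^sub>1\<close>, so it is not dense.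
  A compact set also stays in some \<open>E\<^sub>n\<close> (\<open>compact_bounded_level\<close>): principal ideals of points whose levels
  tend to infinity have a closed union, and the complements of the tails of such a union would be
  an open cover without a finite subcover. If \<open>L_set\<close> were minimal among the closed sets meeting every
  member of a filtered family of compact sets, then a member contained in \<open>E\<^sub>n\<close> and a member missing
  \<open>E\<^sub>n\<close> would both contain a third one, which would be empty.\<close>

section \<open>Tapered sets in monotone convergence spaces\<close>

lemma specialization_trans:
  assumes "(x, y) \<in> specialization X" "(y, z) \<in> specialization X"
  shows "(x, z) \<in> specialization X"
proof -
  have "X closure_of {y} \<subseteq> X closure_of {z}"
    using assms(2) by (intro closure_of_minimal) (auto simp: specialization_def)
  then show ?thesis
    using assms by (auto simp: specialization_def)
qed

text \<open>The sets \<open>X closure_of {u}\<close> are closed, so a set and its closure have the same upper bounds.\<close>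

lemma upper_bound_closure:
  assumes "u \<in> topspace X" "\<forall>x\<in>A. (x, u) \<in> specialization X" "y \<in> X closure_of A"
  shows "(y, u) \<in> specialization X"
proof -
  have "X closure_of A \<subseteq> X closure_of {u}"
    using assms(2) by (intro closure_of_minimal) (auto simp: specialization_def)
  then show ?thesis
    using assms(1,3) closure_of_subset_topspace[of X A] unfolding specialization_def by blast
qed

lemma monotone_convergence_supremum:
  assumes Y: "monotone_convergence_space Y"
    and D: "directed_set (topspace Y) (specialization Y) D"
  shows "\<exists>s. supremum (topspace Y) (specialization Y) D s"
proof -
  obtain s where s: "s \<in> topspace Y" "Y closure_of D = Y closure_of {s}"
    using Y D unfolding monotone_convergence_space_def by blast
  have sub: "D \<subseteq> topspace Y"
    using D by (simp add: directed_set_def)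
  have "(x, s) \<in> specialization Y" if "x \<in> D" for x
    using that s sub closure_of_subset[OF sub] by (auto simp: specialization_def)
  moreover have "s \<in> Y closure_of D"
    using s closure_of_subset[of "{s}" Y] by auto
  ultimately show ?thesis
    using s(1) upper_bound_closure[of _ Y D s] unfolding supremum_def by blast
qed

lemma continuous_map_specialization:
  assumes "continuous_map X Y f" "(x, y) \<in> specialization X"
  shows "(f x, f y) \<in> specialization Y"
proof -
  have "f ` (X closure_of {y}) \<subseteq> Y closure_of (f ` {y})"
    using assms(1) by (rule continuous_map_image_closure_subset)
  then show ?thesis
    using assms continuous_map_image_subset_topspace[OF assms(1)] by (auto simp: specialization_def)
qed

lemma tapered_directed:
  fixes X :: "'a topology"
  assumes X: "t0_space X" and D: "directed_set (topspace X) (specialization X) D"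
  shows "tapered TYPE('b) X D"
  unfolding tapered_def
proof (intro conjI allI impI)
  show "t0_space X" "D \<subseteq> topspace X"
    using assms by (auto simp: directed_set_def)
next
  fix Y :: "'b topology" and f
  assume *: "monotone_convergence_space Y \<and> continuous_map X Y f"
  have "f ` D \<subseteq> topspace Y"
    using * D continuous_map_image_subset_topspace[of X Y f] by (auto simp: directed_set_def)
  moreover have "\<exists>w\<in>f ` D. (u, w) \<in> specialization Y \<and> (v, w) \<in> specialization Y"
    if "u \<in> f ` D" "v \<in> f ` D" for u v
    using that D * continuous_map_specialization[of X Y f] unfolding directed_set_def by blast
  ultimately have "directed_set (topspace Y) (specialization Y) (f ` D)"
    using D unfolding directed_set_def by blast
  then show "\<exists>s. supremum (topspace Y) (specialization Y) (f ` D) s"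
    using * monotone_convergence_supremum by blast
qed

lemma tapered_between_closure:
  fixes X :: "'a topology"
  assumes A: "tapered TYPE('b) X A" and B: "A \<subseteq> B" "B \<subseteq> X closure_of A"
  shows "tapered TYPE('b) X B"
  unfolding tapered_def
proof (intro conjI allI impI)
  show "t0_space X" "B \<subseteq> topspace X"
    using A B closure_of_subset_topspace[of X A] by (auto simp: tapered_def)
next
  fix Y :: "'b topology" and f
  assume *: "monotone_convergence_space Y \<and> continuous_map X Y f"
  then obtain s where s: "supremum (topspace Y) (specialization Y) (f ` A) s"
    using A unfolding tapered_def by blast
  have "f ` B \<subseteq> Y closure_of (f ` A)"
    using * B continuous_map_image_closure_subset[of X Y f A] by blast
  then have "\<forall>y\<in>f ` B. (y, s) \<in> specialization Y"
    using s upper_bound_closure[of s Y "f ` A"] unfolding supremum_def by blast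
  then have "supremum (topspace Y) (specialization Y) (f ` B) s"
    using s B(1) unfolding supremum_def by blast
  then show "\<exists>s. supremum (topspace Y) (specialization Y) (f ` B) s" ..
qed

text \<open>Suprema of larger sets are larger, so the suprema of the images of the members are directed;
  their supremum is the supremum of the image of the union.\<close>

lemma tapered_directed_Union:
  fixes X :: "'a topology"
  assumes ne: "\<A> \<noteq> {}"
    and dir: "\<And>A B. A \<in> \<A> \<Longrightarrow> B \<in> \<A> \<Longrightarrow> \<exists>C\<in>\<A>. A \<union> B \<subseteq> C"
    and tap: "\<And>A. A \<in> \<A> \<Longrightarrow> tapered TYPE('b) X A"
  shows "tapered TYPE('b) X (\<Union>\<A>)"
  unfolding tapered_def
proof (intro conjI allI impI)
  show "t0_space X" "\<Union>\<A> \<subseteq> topspace X"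
    using ne tap by (auto simp: tapered_def)
next
  fix Y :: "'b topology" and f
  assume *: "monotone_convergence_space Y \<and> continuous_map X Y f"
  let ?r = "specialization Y"
  have "\<forall>A\<in>\<A>. \<exists>s. supremum (topspace Y) ?r (f ` A) s"
    using tap * unfolding tapered_def by blast
  then obtain g where g: "\<And>A. A \<in> \<A> \<Longrightarrow> supremum (topspace Y) ?r (f ` A) (g A)"
    by metis
  have mono: "(g A, g B) \<in> ?r" if "A \<in> \<A>" "B \<in> \<A>" "A \<subseteq> B" for A B
    using g[OF that(1)] g[OF that(2)] that(3) unfolding supremum_def by blast
  have "directed_set (topspace Y) ?r (g ` \<A>)"
    unfolding directed_set_def
  proof (intro conjI ballI)
    show "g ` \<A> \<subseteq> topspace Y" "g ` \<A> \<noteq> {}"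
      using g ne unfolding supremum_def by auto
  next
    fix u v assume "u \<in> g ` \<A>" "v \<in> g ` \<A>"
    then obtain A B where AB: "A \<in> \<A>" "B \<in> \<A>" "u = g A" "v = g B"
      by blast
    then obtain C where "C \<in> \<A>" "A \<union> B \<subseteq> C"
      using dir by blast
    then show "\<exists>w\<in>g ` \<A>. (u, w) \<in> ?r \<and> (v, w) \<in> ?r"
      using mono AB by blast
  qed
  then obtain s where s: "supremum (topspace Y) ?r (g ` \<A>) s"
    using * monotone_convergence_supremum by blast
  have "supremum (topspace Y) ?r (f ` \<Union>\<A>) s"
    unfolding supremum_def
  proof (intro conjI ballI impI)
    show "s \<in> topspace Y"
      using s by (simp add: supremum_def)
  next
    fix y assume "y \<in> f ` \<Union>\<A>"
    then obtain A where A: "A \<in> \<A>" "y \<in> f ` A"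
      by blast
    have "(y, g A) \<in> ?r" "(g A, s) \<in> ?r"
      using A g[OF A(1)] s unfolding supremum_def by auto
    then show "(y, s) \<in> ?r"
      by (rule specialization_trans)
  next
    fix u assume u: "u \<in> topspace Y" "\<forall>y\<in>f ` \<Union>\<A>. (y, u) \<in> ?r"
    have "(g A, u) \<in> ?r" if "A \<in> \<A>" for A
    proof -
      have "\<forall>y\<in>f ` A. (y, u) \<in> ?r"
        using u(2) that by blast
      then show ?thesis
        using g[OF that] u(1) by (simp add: supremum_def)
    qed
    then show "(s, u) \<in> ?r"
      using s u(1) by (simp add: supremum_def)
  qed
  then show "\<exists>s. supremum (topspace Y) ?r (f ` \<Union>\<A>) s" ..
qed


section \<open>Scott closed sets and directed sets\<close>

lemma closedin_scott_iff:
  "closedin (scott_topology P r) C \<longleftrightarrow>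
     C \<subseteq> P \<and> (\<forall>x\<in>C. \<forall>y\<in>P. (y, x) \<in> r \<longrightarrow> y \<in> C) \<and>
     (\<forall>D s. directed_set P r D \<and> supremum P r D s \<and> D \<subseteq> C \<longrightarrow> s \<in> C)"
proof (cases "C \<subseteq> P")
  case True
  have "D \<inter> (P - C) = {} \<longleftrightarrow> D \<subseteq> C" if "directed_set P r D" for D
    using that unfolding directed_set_def by blast
  moreover have "s \<in> P" if "supremum P r D s" for D s
    using that by (simp add: supremum_def)
  ultimately have "(\<forall>D s. directed_set P r D \<and> supremum P r D s \<and> s \<in> P - C \<longrightarrow> D \<inter> (P - C) \<noteq> {})
      \<longleftrightarrow> (\<forall>D s. directed_set P r D \<and> supremum P r D s \<and> D \<subseteq> C \<longrightarrow> s \<in> C)"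
    by (metis DiffD2 DiffI)
  moreover have "upper_set P r (P - C) \<longleftrightarrow> (\<forall>x\<in>C. \<forall>y\<in>P. (y, x) \<in> r \<longrightarrow> y \<in> C)"
    using True unfolding upper_set_def by blast
  ultimately show ?thesis
    using True
    by (simp add: closedin_def topspace_scott_topology openin_scott_topology scott_open_def)
qed (simp add: closedin_def topspace_scott_topology)

lemma closure_scott_lower:
  assumes "x \<in> scott_topology P r closure_of A" "y \<in> P" "(y, x) \<in> r"
  shows "y \<in> scott_topology P r closure_of A"
  using closedin_closure_of[of "scott_topology P r" A] assms
  unfolding closedin_scott_iff by blast

lemma closure_scott_supremum:
  assumes "directed_set P r D" "supremum P r D s" "D \<subseteq> scott_topology P r closure_of A"
  shows "s \<in> scott_topology P r closure_of A"
  using closedin_closure_of[of "scott_topology P r" A] assms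
  unfolding closedin_scott_iff by blast

lemma order_imp_specialization_scott:
  assumes "x \<in> P" "y \<in> P" "(x, y) \<in> r"
  shows "(x, y) \<in> specialization (scott_topology P r)"
proof -
  have "y \<in> scott_topology P r closure_of {y}"
    using assms(2) closure_of_subset[of "{y}" "scott_topology P r"]
    by (simp add: topspace_scott_topology)
  then have "x \<in> scott_topology P r closure_of {y}"
    using closure_scott_lower assms(1,3) by metis
  then show ?thesis
    using assms by (simp add: specialization_def topspace_scott_topology)
qed

lemma directed_set_finite_bound:
  assumes "directed_set P r D" "trans r" "finite F" "F \<subseteq> D"
  shows "\<exists>z\<in>D. \<forall>x\<in>F. (x, z) \<in> r"
  using assms(3,4)
proof (induction F rule: finite_induct)
  case empty
  then show ?case
    using assms(1) unfolding directed_set_def by blast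
next
  case (insert x F)
  then obtain z where z: "z \<in> D" "\<forall>x\<in>F. (x, z) \<in> r"
    by blast
  then obtain w where w: "w \<in> D" "(x, w) \<in> r" "(z, w) \<in> r"
    using assms(1) insert.prems unfolding directed_set_def by blast
  then have "\<forall>y\<in>insert x F. (y, w) \<in> r"
    using z(2) assms(2) by (auto dest: transD)
  then show ?case
    using w(1) by blast
qed

lemma directed_set_below_finite:
  assumes D: "directed_set P r D" and r: "trans r" and A: "finite A"
    and cover: "\<And>x. x \<in> D \<Longrightarrow> \<exists>a\<in>A. (x, a) \<in> r"
  shows "\<exists>a\<in>A. \<forall>x\<in>D. (x, a) \<in> r"
proof (rule ccontr)
  assume "\<not> ?thesis"
  then obtain d where d: "\<And>a. a \<in> A \<Longrightarrow> d a \<in> D \<and> (d a, a) \<notin> r"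
    by metis
  then obtain z where z: "z \<in> D" "\<forall>x\<in>d ` A. (x, z) \<in> r"
    using directed_set_finite_bound[OF D r, of "d ` A"] A by blast
  obtain a where a: "a \<in> A" "(z, a) \<in> r"
    using cover z(1) by blast
  then have "(d a, a) \<in> r"
    using z(2) r by (meson imageI transD)
  then show False
    using d a(1) by blast
qed


section \<open>The order of the poset\<close>

text \<open>The second disjunct of the first case is the path up the column to height \<open>i2\<close>, across to the
  diagonal point \<open>(n1, i2, i2)\<close> and up that column. The level changes at most once on a path,
  because \<open>(n2, i2, \<infinity>)\<close> is maximal.\<close>

lemma L_order_iff:
  "((n1, i1, j1), (n2, i2, j2)) \<in> L_order \<longleftrightarrow>
     (n1, i1, j1) \<in> L_set \<and> (n2, i2, j2) \<in> L_set \<and>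
     (n1 = n2 \<and> (i1 = i2 \<and> j1 \<le> j2 \<or> i1 \<le> i2 \<and> j1 \<le> enat i2 \<and> enat i2 \<le> j2) \<or>
      n2 = Suc n1 \<and> j1 \<le> enat i2 \<and> j2 = \<infinity>)"
  (is "_ \<longleftrightarrow> ?R n1 i1 j1 n2 i2 j2")
proof
  have trans: "?R n1 i1 j1 n3 i3 j3"
    if "?R n1 i1 j1 n2 i2 j2" "((n2, i2, j2), (n3, i3, j3)) \<in> L_step"
    for n1 i1 j1 n2 i2 j2 n3 i3 j3
    using that unfolding L_step_def by (auto intro: order_trans)
  have in_step: "?R n1 i1 j1 n2 i2 j2" if "((n1, i1, j1), (n2, i2, j2)) \<in> L_step"
    for n1 i1 j1 n2 i2 j2
    using that unfolding L_step_def by auto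
  have "case x of (n1, i1, j1) \<Rightarrow> case y of (n2, i2, j2) \<Rightarrow> ?R n1 i1 j1 n2 i2 j2"
    if "(x, y) \<in> L_step\<^sup>+" for x y
    using that
  proof (induction rule: trancl_induct)
    case (base y)
    then show ?case
      using in_step by (cases x; cases y) blast
  next
    case (step y z)
    obtain n1 i1 j1 n2 i2 j2 n3 i3 j3
      where "x = (n1, i1, j1)" "y = (n2, i2, j2)" "z = (n3, i3, j3)"
      by (metis prod_cases3)
    then show ?case
      using trans[of n1 i1 j1 n2 i2 j2 n3 i3 j3] step.hyps(2) step.IH by simp
  qed
  then show "?R n1 i1 j1 n2 i2 j2" if "((n1, i1, j1), (n2, i2, j2)) \<in> L_order"
    using that unfolding L_order_def by blast
next
  assume R: "?R n1 i1 j1 n2 i2 j2"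
  show "((n1, i1, j1), (n2, i2, j2)) \<in> L_order"
  proof (cases "n1 = n2 \<and> i1 \<le> i2 \<and> j1 \<le> enat i2 \<and> enat i2 \<le> j2")
    case True
    have "1 \<le> enat i2"
      using R by (simp add: L_set_def one_enat_def)
    then have "((n1, i1, j1), (n1, i1, enat i2)) \<in> L_step"
      and "((n1, i1, enat i2), (n1, i2, enat i2)) \<in> L_step"
      and "((n1, i2, enat i2), (n1, i2, j2)) \<in> L_step"
      using R True unfolding L_step_def L_set_def by auto
    then show ?thesis
      using True unfolding L_order_def by (meson trancl.simps)
  next
    case False
    then have "((n1, i1, j1), (n2, i2, j2)) \<in> L_step"
      using R unfolding L_step_def by auto
    then show ?thesis
      unfolding L_order_def by blast
  qed
qed

lemma trans_L_order: "trans L_order"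
  unfolding L_order_def by (rule trans_trancl)

lemma partial_order_L: "partial_order_on L_set L_order"
  unfolding partial_order_on_def preorder_on_def
proof (intro conjI)
  show "L_order \<subseteq> L_set \<times> L_set"
    by (auto simp: L_order_iff)
  show "refl_on L_set L_order"
    unfolding refl_on_def by (auto simp: L_order_iff)
  show "trans L_order"
    by (rule trans_L_order)
  show "antisym L_order"
    unfolding antisym_def by (auto simp: L_order_iff)
qed

lemma L_order_in_L_set: "(x, y) \<in> L_order \<Longrightarrow> x \<in> L_set \<and> y \<in> L_set"
  by (cases x; cases y) (simp add: L_order_iff)

lemma L_order_refl: "x \<in> L_set \<Longrightarrow> (x, x) \<in> L_order"
  by (cases x) (simp add: L_order_iff)

lemma L_order_level: "(x, y) \<in> L_order \<Longrightarrow> fst x \<le> fst y \<and> fst y \<le> Suc (fst x)"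
  by (cases x; cases y) (auto simp: L_order_iff)

lemma directed_level_bound:
  assumes "directed_set L_set L_order D" "d \<in> D" "e \<in> D"
  shows "\<exists>z\<in>D. (e, z) \<in> L_order \<and> fst z \<le> Suc (fst d)"
  using assms L_order_level unfolding directed_set_def by blast

abbreviation scott_L :: "(nat \<times> nat \<times> enat) topology" where
  "scott_L \<equiv> scott_topology L_set L_order"


section \<open>Closed sets bounded in level and compactness\<close>

text \<open>A supremum outside these levels would be some \<open>(n + 1, i, \<infinity>)\<close>, reached from a subset of level
  \<open>n\<close>; but then \<open>(n + 1, i + 1, \<infinity>)\<close> is an incomparable upper bound of the same subset.\<close>

lemma closedin_levels: "closedin scott_L {x \<in> L_set. fst x \<le> n}"
  unfolding closedin_scott_iff
proof (intro conjI ballI allI impI)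
  fix x y assume "x \<in> {x \<in> L_set. fst x \<le> n}" "y \<in> L_set" "(y, x) \<in> L_order"
  then show "y \<in> {x \<in> L_set. fst x \<le> n}"
    using L_order_level[of y x] by auto
next
  fix D s
  assume *: "directed_set L_set L_order D \<and> supremum L_set L_order D s
    \<and> D \<subseteq> {x \<in> L_set. fst x \<le> n}"
  then have s: "s \<in> L_set" "\<And>x. x \<in> D \<Longrightarrow> (x, s) \<in> L_order"
    "\<And>u. u \<in> L_set \<Longrightarrow> (\<forall>x\<in>D. (x, u) \<in> L_order) \<Longrightarrow> (s, u) \<in> L_order"
    unfolding supremum_def by auto
  have "fst s \<le> n"
  proof (rule ccontr)
    assume above: "\<not> fst s \<le> n"
    obtain d where d: "d \<in> D"
      using * unfolding directed_set_def by blast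
    obtain m i j where sm: "s = (m, i, j)"
      by (metis prod_cases3)
    have "fst d \<le> n" using d * by auto
    then have "fst d < m" using above sm by simp
    then have j: "j = \<infinity>"
      using s(2)[OF d] sm by (cases d) (auto simp: L_order_iff)
    have u: "(m, Suc i, \<infinity>) \<in> L_set"
      using s(1) sm by (simp add: L_set_def)
    have "(x, (m, Suc i, \<infinity>)) \<in> L_order" if "x \<in> D" for x
    proof -
      have "fst x < m"
        using that * above sm by auto
      moreover have "j' \<le> enat (Suc i)" if "j' \<le> enat i" for j'
        using that by (rule order_trans) simp
      ultimately show ?thesis
        using s(2)[OF that] sm u by (cases x) (auto simp: L_order_iff)
    qed
    then have "(s, (m, Suc i, \<infinity>)) \<in> L_order"
      using s(3)[OF u] by blast
    then show False
      using sm j by (simp add: L_order_iff)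
  qed
  then show "s \<in> {x \<in> L_set. fst x \<le> n}"
    using s(1) by simp
qed auto

text \<open>Given \<open>d \<in> D\<close>, every element of a directed set \<open>D\<close> lies below an element of \<open>D\<close> that is also
  above \<open>d\<close>, hence at most one level higher than \<open>d\<close>. So only finitely many of the principal ideals matter for it, and it lies in one of them.\<close>

lemma closedin_locally_finite_ideals:
  assumes fin: "\<And>p. finite {a \<in> A. fst a \<le> p}"
  shows "closedin scott_L {x. \<exists>a\<in>A. (x, a) \<in> L_order}"
  unfolding closedin_scott_iff
proof (intro conjI ballI allI impI)
  show "{x. \<exists>a\<in>A. (x, a) \<in> L_order} \<subseteq> L_set"
    using L_order_in_L_set by blast
next
  fix x y assume "x \<in> {x. \<exists>a\<in>A. (x, a) \<in> L_order}" "(y, x) \<in> L_order"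
  then show "y \<in> {x. \<exists>a\<in>A. (x, a) \<in> L_order}"
    using transD[OF trans_L_order] by blast
next
  fix D s
  assume *: "directed_set L_set L_order D \<and> supremum L_set L_order D s
    \<and> D \<subseteq> {x. \<exists>a\<in>A. (x, a) \<in> L_order}"
  then obtain d where d: "d \<in> D"
    unfolding directed_set_def by blast
  have "\<exists>a\<in>{a \<in> A. fst a \<le> fst d + 2}. (e, a) \<in> L_order" if e: "e \<in> D" for e
  proof -
    obtain z where z: "z \<in> D" "(e, z) \<in> L_order" "fst z \<le> Suc (fst d)"
      using directed_level_bound[OF conjunct1[OF *] d e] by blast
    then obtain a where a: "a \<in> A" "(z, a) \<in> L_order"
      using * by blast
    then have "fst a \<le> fst d + 2"
      using z(3) L_order_level[of z a] by auto
    then show ?thesis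
      using a z(2) transD[OF trans_L_order] by blast
  qed
  then obtain a where a: "a \<in> A" "\<forall>e\<in>D. (e, a) \<in> L_order"
    using directed_set_below_finite[OF _ trans_L_order fin, of L_set D "fst d + 2"] * by blast
  moreover have "a \<in> L_set"
    using a(2) d L_order_in_L_set by blast
  ultimately have "(s, a) \<in> L_order"
    using * unfolding supremum_def by blast
  then show "s \<in> {x. \<exists>a\<in>A. (x, a) \<in> L_order}"
    using a(1) by blast
qed

lemma t0_space_scott_L: "t0_space scott_L"
  unfolding t0_space_def topspace_scott_topology
proof (intro ballI impI)
  have sep: "\<exists>U. openin scott_L U \<and> x \<in> U \<and> y \<notin> U"
    if "x \<in> L_set" "y \<in> L_set" "(x, y) \<notin> L_order" for x y
  proof -
    have "closedin scott_L {z. \<exists>a\<in>{y}. (z, a) \<in> L_order}"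
      by (rule closedin_locally_finite_ideals) simp
    then have "openin scott_L (L_set - {z. \<exists>a\<in>{y}. (z, a) \<in> L_order})"
      by (simp add: closedin_def topspace_scott_topology)
    then show ?thesis
      using that L_order_refl[OF that(2)] by blast
  qed
  fix x y assume xy: "x \<in> L_set" "y \<in> L_set" "x \<noteq> y"
  have "antisym L_order"
    using partial_order_L by (simp add: partial_order_on_def)
  then have "(x, y) \<notin> L_order \<or> (y, x) \<notin> L_order"
    using xy(3) by (meson antisymD)
  then show "\<exists>U. openin scott_L U \<and> (x \<notin> U) = (y \<in> U)"
    using sep[OF xy(1,2)] sep[OF xy(2,1)] by blast
qed

lemma compact_bounded_level:
  assumes K: "compactin scott_L K"
  shows "\<exists>N. \<forall>x\<in>K. fst x \<le> N"
proof (rule ccontr)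
  assume "\<not> ?thesis"
  then have "\<forall>m. \<exists>x\<in>K. m < fst x"
    by (meson not_le)
  then obtain x where x: "\<And>m. x m \<in> K" "\<And>m. m < fst (x m)"
    by metis
  have KL: "K \<subseteq> L_set"
    using K by (simp add: compactin_def topspace_scott_topology)
  \<comment> \<open>The closed sets \<open>C m\<close> decrease with empty intersection, but each of them meets \<open>K\<close>.\<close>
  define C where "C m = {y. \<exists>a\<in>x ` {m..}. (y, a) \<in> L_order}" for m
  define U where "U m = L_set - C m" for m
  have "closedin scott_L (C m)" for m
    unfolding C_def
  proof (rule closedin_locally_finite_ideals)
    fix p
    have "{a \<in> x ` {m..}. fst a \<le> p} \<subseteq> x ` {..p}"
    proof
      fix a assume "a \<in> {a \<in> x ` {m..}. fst a \<le> p}"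
      then obtain k where "a = x k" "fst (x k) \<le> p"
        by blast
      then show "a \<in> x ` {..p}"
        using x(2)[of k] by auto
    qed
    then show "finite {a \<in> x ` {m..}. fst a \<le> p}"
      by (rule finite_subset) simp
  qed
  then have op: "openin scott_L (U m)" for m
    by (simp add: U_def closedin_def topspace_scott_topology)
  have "y \<in> U (fst y + 2)" if "y \<in> K" for y
  proof -
    have "(y, x k) \<notin> L_order" if "fst y + 2 \<le> k" for k
      using that x(2)[of k] L_order_level[of y "x k"] by auto
    then show ?thesis
      using that KL unfolding U_def C_def by auto
  qed
  then have "K \<subseteq> \<Union>(range U)"
    by blast
  then obtain F where F: "finite F" "F \<subseteq> range U" "K \<subseteq> \<Union>F"
    using K op unfolding compactin_def by (metis (no_types, lifting) imageE)
  then obtain I where I: "finite I" "F = U ` I"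
    by (meson finite_subset_image)
  define M where "M = Max (insert 0 I)"
  obtain i where i: "i \<in> I" "x M \<in> U i"
    using x(1)[of M] F(3) I(2) by blast
  have "i \<le> M"
    using i(1) I(1) by (simp add: M_def)
  moreover have "(x M, x M) \<in> L_order"
    using x(1) KL by (blast intro: L_order_refl)
  ultimately have "x M \<in> C i"
    unfolding C_def by auto
  then show False
    using i(2) by (simp add: U_def)
qed

lemma levels_neq_L: "{x \<in> L_set. fst x \<le> n} \<noteq> L_set"
proof -
  have "(Suc n, 1, 1) \<in> L_set"
    by (simp add: L_set_def)
  then show ?thesis
    by force
qed

lemma L_set_not_KF: "L_set \<notin> KF scott_L"
proof
  assume KF: "L_set \<in> KF scott_L"
  have "scott_L closure_of L_set = L_set"
    using closure_of_topspace[of scott_L] by (simp add: topspace_scott_topology)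
  then have "\<exists>\<K>. \<K> \<subseteq> compact_saturated scott_L \<and> filtered_family \<K> \<and>
      L_set \<in> closed_meeting scott_L \<K> \<and>
      (\<forall>C\<in>closed_meeting scott_L \<K>. C \<subseteq> L_set \<longrightarrow> C = L_set)"
    using KF by (simp add: KF_def KF_set_def)
  then obtain \<K> where \<K>: "\<K> \<subseteq> compact_saturated scott_L" "filtered_family \<K>"
    and meet: "L_set \<in> closed_meeting scott_L \<K>"
    and minimal: "\<And>C. C \<in> closed_meeting scott_L \<K> \<Longrightarrow> C \<subseteq> L_set \<Longrightarrow> C = L_set"
    by meson
  obtain K where K: "K \<in> \<K>"
    using \<K>(2) unfolding filtered_family_def by blast
  then obtain N where N: "\<forall>x\<in>K. fst x \<le> N"
    using \<K>(1) compact_bounded_level unfolding compact_saturated_def by blast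
  let ?E = "{x \<in> L_set. fst x \<le> N}"
  have "?E \<notin> closed_meeting scott_L \<K>"
    using minimal[of ?E] levels_neq_L by blast
  then obtain K' where K': "K' \<in> \<K>" "?E \<inter> K' = {}"
    using closedin_levels unfolding closed_meeting_def by blast
  obtain K'' where "K'' \<in> \<K>" "K'' \<subseteq> K \<inter> K'"
    using \<K>(2) K K'(1) unfolding filtered_family_def by blast
  moreover from this have "L_set \<inter> K'' \<noteq> {}"
    using meet unfolding closed_meeting_def by blast
  ultimately show False
    using N K'(2) by blast
qed

lemma directed_not_dense:
  assumes D: "directed_set L_set L_order D"
  shows "scott_L closure_of D \<noteq> L_set"
proof -
  obtain d where d: "d \<in> D"
    using D unfolding directed_set_def by blast
  have "D \<subseteq> {x \<in> L_set. fst x \<le> Suc (fst d)}"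
  proof
    fix e assume e: "e \<in> D"
    then obtain z where "(e, z) \<in> L_order" "fst z \<le> Suc (fst d)"
      using directed_level_bound[OF D d e] by blast
    then show "e \<in> {x \<in> L_set. fst x \<le> Suc (fst d)}"
      using L_order_level[of e z] L_order_in_L_set[of e z] by auto
  qed
  then have "scott_L closure_of D \<subseteq> {x \<in> L_set. fst x \<le> Suc (fst d)}"
    using closedin_levels by (rule closure_of_minimal)
  moreover have "{x \<in> L_set. fst x \<le> Suc (fst d)} \<subset> L_set"
    using levels_neq_L[of "Suc (fst d)"] by (intro psubsetI) auto
  ultimately show ?thesis
    by (metis order_le_less_trans order_less_irrefl)
qed


section \<open>Approximation by diagonals\<close>

definition diagonal :: "nat \<Rightarrow> (nat \<times> nat \<times> enat) set" where
  "diagonal n = (\<lambda>k. (n, k, enat k)) ` {1..}"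

lemma directed_diagonal:
  assumes "1 \<le> n"
  shows "directed_set L_set L_order (diagonal n)"
  unfolding directed_set_def
proof (intro conjI ballI)
  show "diagonal n \<subseteq> L_set" "diagonal n \<noteq> {}"
    using assms by (auto simp: diagonal_def L_set_def one_enat_def)
next
  fix x y assume "x \<in> diagonal n" "y \<in> diagonal n"
  then obtain k l where kl: "x = (n, k, enat k)" "1 \<le> k" "y = (n, l, enat l)" "1 \<le> l"
    unfolding diagonal_def by auto
  show "\<exists>z\<in>diagonal n. (x, z) \<in> L_order \<and> (y, z) \<in> L_order"
    using assms kl
    by (intro bexI[of _ "(n, max k l, enat (max k l))"])
       (auto simp: L_order_iff L_set_def one_enat_def diagonal_def)
qed

text \<open>An upper bound of a whole column \<open>i\<close> of level \<open>n\<close> that lies in a column \<open>a\<close> is above the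
  point of height greater than \<open>a\<close>, which is possible only inside the column \<open>i\<close>.\<close>

lemma column_closure:
  assumes n: "1 \<le> n" "1 \<le> i"
    and col: "\<And>k. 1 \<le> k \<Longrightarrow> (n, i, enat k) \<in> scott_L closure_of A"
  shows "(n, i, \<infinity>) \<in> scott_L closure_of A"
proof (rule closure_scott_supremum)
  let ?D = "(\<lambda>k. (n, i, enat k)) ` {1..}"
  have L: "(n, i, enat k) \<in> L_set" if "1 \<le> k" for k
    using n that by (simp add: L_set_def one_enat_def)
  show "?D \<subseteq> scott_L closure_of A"
    using col by auto
  show "directed_set L_set L_order ?D"
    unfolding directed_set_def
  proof (intro conjI ballI)
    show "?D \<subseteq> L_set" "?D \<noteq> {}"
      using L by auto
  next
    fix x y assume "x \<in> ?D" "y \<in> ?D"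
    then obtain k l where kl: "x = (n, i, enat k)" "1 \<le> k" "y = (n, i, enat l)" "1 \<le> l"
      by auto
    show "\<exists>z\<in>?D. (x, z) \<in> L_order \<and> (y, z) \<in> L_order"
      using kl L by (intro bexI[of _ "(n, i, enat (max k l))"]) (auto simp: L_order_iff)
  qed
  show "supremum L_set L_order ?D (n, i, \<infinity>)"
    unfolding supremum_def
  proof (intro conjI ballI impI)
    show top: "(n, i, \<infinity>) \<in> L_set"
      using n by (simp add: L_set_def)
    show "(x, (n, i, \<infinity>)) \<in> L_order" if "x \<in> ?D" for x
      using that L top by (auto simp: L_order_iff)
    fix u assume u: "u \<in> L_set" "\<forall>x\<in>?D. (x, u) \<in> L_order"
    obtain m a b where uab: "u = (m, a, b)"
      by (metis prod_cases3)
    have bd: "((n, i, enat k), (m, a, b)) \<in> L_order" if "1 \<le> k" for k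
      using u(2) uab that by auto
    have eq: "m = n" "a = i"
      using bd[of "Suc a"] by (auto simp: L_order_iff)
    have "enat k \<le> b" for k
      using bd[of "Suc k + a"] eq order_trans[of "enat k" "enat (Suc k + a)" b]
      by (auto simp: L_order_iff)
    then have "b = \<infinity>"
      by (metis enat_ord_simps(1) not_infinity_eq not_less_eq_eq order_refl)
    then show "((n, i, \<infinity>), u) \<in> L_order"
      using eq uab top L_order_refl by simp
  qed
qed

lemma level_subset_closure:
  assumes fin: "\<And>i k. 1 \<le> i \<Longrightarrow> 1 \<le> k \<Longrightarrow> (n, i, enat k) \<in> scott_L closure_of A"
    and x: "x \<in> L_set" "fst x = n"
  shows "x \<in> scott_L closure_of A"
proof -
  obtain i j where xij: "x = (n, i, j)" "1 \<le> n" "1 \<le> i" "1 \<le> j"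
    using x by (cases x) (auto simp: L_set_def)
  show ?thesis
  proof (cases j)
    case (enat k)
    then show ?thesis
      using xij fin by (simp add: one_enat_def)
  next
    case infinity
    then show ?thesis
      using xij fin column_closure by blast
  qed
qed

text \<open>Descending induction on the level: once level \<open>m + 1\<close> is in the closure, so are the points of
  level \<open>m\<close> and finite height \<open>k\<close>, which lie below \<open>(m + 1, k, \<infinity>)\<close>.\<close>

lemma levels_subset_closure_diagonal:
  assumes n: "1 \<le> n" and x: "x \<in> L_set" "fst x \<le> n"
  shows "x \<in> scott_L closure_of (diagonal n)"
proof -
  have "\<forall>x\<in>L_set. fst x = m \<longrightarrow> x \<in> scott_L closure_of (diagonal n)" if "m \<le> n" "1 \<le> m" for m
    using that
  proof (induction m rule: inc_induct)
    case base
    have "(n, i, enat k) \<in> scott_L closure_of (diagonal n)" if ik: "1 \<le> i" "1 \<le> k" for i k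
    proof (rule closure_scott_lower)
      let ?d = "(n, max i k, enat (max i k))"
      have "diagonal n \<subseteq> scott_L closure_of (diagonal n)"
        using directed_diagonal[OF n]
        by (intro closure_of_subset) (simp add: directed_set_def topspace_scott_topology)
      then show "?d \<in> scott_L closure_of (diagonal n)"
        using ik by (auto simp: diagonal_def)
      show "(n, i, enat k) \<in> L_set" "((n, i, enat k), ?d) \<in> L_order"
        using n ik by (auto simp: L_order_iff L_set_def one_enat_def)
    qed
    then show ?case
      using level_subset_closure by blast
  next
    case (step m)
    have "(m, i, enat k) \<in> scott_L closure_of (diagonal n)" if ik: "1 \<le> i" "1 \<le> k" for i k
    proof (rule closure_scott_lower)
      have "(Suc m, k, \<infinity>) \<in> L_set"
        using ik by (simp add: L_set_def)
      then show "(Suc m, k, \<infinity>) \<in> scott_L closure_of (diagonal n)"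
        using step.IH by simp
      show "(m, i, enat k) \<in> L_set" "((m, i, enat k), (Suc m, k, \<infinity>)) \<in> L_order"
        using step.prems ik by (auto simp: L_order_iff L_set_def one_enat_def)
    qed
    then show ?case
      using level_subset_closure by blast
  qed
  moreover have "1 \<le> fst x"
    using x(1) by (cases x) (simp add: L_set_def)
  ultimately show ?thesis
    using x by blast
qed

lemma tapered_levels:
  assumes n: "1 \<le> n"
  shows "tapered TYPE('b) scott_L {x \<in> L_set. fst x \<le> n}"
proof (rule tapered_between_closure)
  have D: "directed_set L_set L_order (diagonal n)"
    using directed_diagonal n .
  then have "directed_set (topspace scott_L) (specialization scott_L) (diagonal n)"
    using order_imp_specialization_scott[of _ L_set _ L_order]
    unfolding directed_set_def topspace_scott_topology by (meson subsetD)
  then show "tapered TYPE('b) scott_L (diagonal n)"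
    by (rule tapered_directed[OF t0_space_scott_L])
  show "diagonal n \<subseteq> {x \<in> L_set. fst x \<le> n}"
    using D by (auto simp: directed_set_def diagonal_def)
  show "{x \<in> L_set. fst x \<le> n} \<subseteq> scott_L closure_of (diagonal n)"
    using levels_subset_closure_diagonal[OF n] by blast
qed

lemma tapered_L_set: "tapered TYPE('b) scott_L L_set"
proof -
  let ?E = "\<lambda>n. {x \<in> L_set. fst x \<le> n}"
  have "tapered TYPE('b) scott_L (\<Union>(?E ` {1..}))"
  proof (rule tapered_directed_Union)
    fix A B assume "A \<in> ?E ` {1..}" "B \<in> ?E ` {1..}"
    then obtain m n where mn: "1 \<le> m" "1 \<le> n" "A = ?E m" "B = ?E n"
      by auto
    have "A \<union> B \<subseteq> ?E (max m n)"
      using mn(3,4) by auto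
    then show "\<exists>C\<in>?E ` {1..}. A \<union> B \<subseteq> C"
      using mn(1) by (intro bexI[of _ "?E (max m n)"]) auto
  qed (auto intro: tapered_levels)
  moreover have "\<Union>(?E ` {1..}) = L_set"
    by (auto simp: L_set_def)
  ultimately show ?thesis
    by simp
qed

theorem mainTheorem7:
  shows "partial_order_on L_set L_order
       \<and> closedin (scott_topology L_set L_order) L_set
       \<and> tapered TYPE('b) (scott_topology L_set L_order) L_set
       \<and> L_set \<notin> KF (scott_topology L_set L_order)
       \<and> \<not> (\<exists>D. directed_set L_set L_order D
              \<and> scott_topology L_set L_order closure_of D = L_set)"
proof -
  have "closedin scott_L L_set"
    using closedin_topspace[of scott_L] by (simp add: topspace_scott_topology)
  then show ?thesis
    using partial_order_L tapered_L_set L_set_not_KF directed_not_dense by blast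
qed

end
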